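(* There exist a potential $W\in C^2(\mathbb{R}^2,\mathbb{R})$, a number $T>0$ and a solution $u:\mathbb{R}\to\mathbb{R}^2$ of the ordinary differential equation $\frac{\mathrm{d}^2u}{\mathrm{d}x^2}=\nabla W(u)$ on $\mathbb{R}$ such that, with $a^{\pm}=(\pm 2,0)$: (a) $W(a^{\pm})=0$ and $W(v)>0$ for every $v\in\mathbb{R}^2\setminus\{a^+,a^-\}$; (b) the Hessian matrices $D^2W(a^{+})$ and $D^2W(a^-)$ are positive definite; (c) $W$ is symmetric with respect to the coordinate axes, i.e. $W(v_1,v_2)=W(-v_1,v_2)=W(v_1,-v_2)$ for all $(v_1,v_2)\in\mathbb{R}^2$; (d) $u(x+T)=u(x)$ for all $x\in\mathbb{R}$; (e) $u(0)=a^+$ and $u(T/2)=a^-$; (f) $\frac{\mathrm{d}u}{\mathrm{d}x}(0)\neq 0$ and $\frac{\mathrm{d}u}{\mathrm{d}x}(T/2)\neq 0$. In particular, $u$ is a bounded non-constant solution with $W(u(0))=0$ and $\frac12\left|\frac{\mathrm{d}u}{\mathrm{d}x}(0)\right|^2>W(u(0))$. *)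

theory Defs
  imports "HOL-Analysis.Analysis"
begin

definition grad :: "(real^'n \<Rightarrow> real) \<Rightarrow> real^'n \<Rightarrow> real^'n" where
  "grad f x = (THE D. GDERIV f x :> D)"

definition hessian :: "(real^'n \<Rightarrow> real) \<Rightarrow> real^'n \<Rightarrow> real^'n^'n" where
  "hessian f x = matrix (frechet_derivative (grad f) (at x))"

text \<open>Differentiability of \<open>f\<close> and of \<open>grad f\<close> is demanded explicitly because the values of
  \<open>grad\<close> and \<open>hessian\<close> are unspecified where the derivatives do not exist.\<close>

definition C2 :: "(real^'n \<Rightarrow> real) \<Rightarrow> bool" where
  "C2 f \<longleftrightarrow> (\<forall>x. f differentiable at x) \<and> (\<forall>x. grad f differentiable at x) \<and>
     continuous_on UNIV (hessian f)"

definition positive_definite :: "real^'n^'n \<Rightarrow> bool" where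
  "positive_definite A \<longleftrightarrow> transpose A = A \<and> (\<forall>v. v \<noteq> 0 \<longrightarrow> v \<bullet> (A *v v) > 0)"

text \<open>Classical solutions on the whole real line of \<open>u'' = \<nabla>W(u)\<close>.\<close>

definition solves_ode :: "(real^'n \<Rightarrow> real) \<Rightarrow> (real \<Rightarrow> real^'n) \<Rightarrow> bool" where
  "solves_ode W u \<longleftrightarrow> (\<forall>x. u differentiable at x) \<and>
     (\<forall>x. ((\<lambda>y. vector_derivative u (at y)) has_vector_derivative grad W (u x)) (at x))"

definition a_plus :: "real^2" where "a_plus = vector [2, 0]"

definition a_minus :: "real^2" where "a_minus = vector [-2, 0]"

end

theory Submission
  imports Defs
begin

text \<open>The orbit is the epicyclic curve \<open>u(x) = (9 e\<^sup>i\<^sup>x - e\<^sup>3\<^sup>i\<^sup>x) / 4\<close>, whose velocity does not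
  vanish and whose acceleration vanishes at \<open>\<plusminus>2\<close>. With \<open>\<sigma> = sin\<^sup>2 x\<close> it satisfies
  \<open>|u|\<^sup>2 = 4 + 9\<sigma>/4\<close>, so on it \<open>\<sigma>\<close> equals the quadratic polynomial \<open>S(v) = 4(|v|\<^sup>2 - 4)/9\<close>, and
  \<open>q = v\<^sub>2\<^sup>2\<close> equals \<open>b(S) = S(3/2 + S)\<^sup>2\<close>. The equation of motion then prescribes
  \<open>\<partial>W/\<partial>q = 9 / ((3 + 2S)(2 + S))\<close> on the curve, and conservation of energy prescribes
  \<open>W = 27S/8\<close>; both hold for
  \<open>W = 9q / ((3 + 2S)(2 + S)) - 9S\<^sup>2 / (8(2 + S)) + (q - b(S))\<^sup>2\<close>. In the half-plane
  \<open>q \<ge> 0\<close> the curve \<open>q = b(S)\<close> also has the isolated point \<open>S = -3/2\<close>, \<open>q = 0\<close>, where this formula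
  has a pole and \<open>27S/8\<close> is negative. Since \<open>S \<ge> 0\<close> on the orbit, one is free to add multiples of
  the \<open>C\<^sup>2\<close> function \<open>|S|\<^sup>3 - S\<^sup>3\<close>, which vanishes for \<open>S \<ge> 0\<close>: once in the denominator to
  remove the pole, and once in \<open>W\<close> to make it positive for \<open>S < 0\<close>.\<close>

section \<open>The cubic correction supported on negative arguments\<close>

definition kink :: "real \<Rightarrow> real" where
  "kink s = \<bar>s\<bar> ^ 3 - s ^ 3"

definition kink1 :: "real \<Rightarrow> real" where
  "kink1 s = 3 * s * \<bar>s\<bar> - 3 * s\<^sup>2"

definition kink2 :: "real \<Rightarrow> real" where
  "kink2 s = 6 * \<bar>s\<bar> - 6 * s"

lemma kink_nonneg_arg:
  assumes "s \<ge> 0"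
  shows "kink s = 0" "kink1 s = 0" "kink2 s = 0"
  using assms by (simp_all add: kink_def kink1_def kink2_def power2_eq_square)

lemma kink_neg_arg: "s \<le> 0 \<Longrightarrow> kink s = - 2 * s ^ 3"
  by (simp add: kink_def)

text \<open>At 0 the difference quotient is \<open>\<bar>h\<bar>\<close>; elsewhere the function is
  locally \<open>s\<^sup>2\<close> or \<open>- s\<^sup>2\<close>. Both derivatives of
  \<open>kink\<close> reduce to this one, since
  \<open>\<bar>s\<bar> ^ 3 = s * (s * \<bar>s\<bar>)\<close> has derivative
  \<open>3 * (s * \<bar>s\<bar>)\<close>.\<close>

lemma DERIV_mult_abs: "DERIV (\<lambda>s. s * \<bar>s\<bar>) s :> 2 * \<bar>s::real\<bar>"
proof -
  consider "s = 0" | "s > 0" | "s < 0" by linarith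
  then show ?thesis
  proof cases
    case 1
    have "(\<lambda>h::real. \<bar>h\<bar>) \<midarrow>0\<rightarrow> 0"
      using tendsto_rabs_zero[OF tendsto_ident_at, of "UNIV"] by simp
    then have "(\<lambda>h::real. (h * \<bar>h\<bar>) / h) \<midarrow>0\<rightarrow> 0"
      by (rule Lim_transform_eventually) (auto simp: eventually_at_filter)
    with 1 show ?thesis
      by (simp add: DERIV_def)
  next
    case 2
    have "DERIV (\<lambda>s. s\<^sup>2) s :> 2 * \<bar>s\<bar>"
      using 2 by (auto intro!: derivative_eq_intros)
    then show ?thesis
      by (rule has_field_derivative_transform_within_open [of _ _ _ "{0<..}"])
        (use 2 in \<open>auto simp: power2_eq_square\<close>)
  next
    case 3
    have "DERIV (\<lambda>s. - s\<^sup>2) s :> 2 * \<bar>s\<bar>"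
      using 3 by (auto intro!: derivative_eq_intros)
    then show ?thesis
      by (rule has_field_derivative_transform_within_open [of _ _ _ "{..<0}"])
        (use 3 in \<open>auto simp: power2_eq_square\<close>)
  qed
qed

lemma DERIV_kink [derivative_intros]:
  "DERIV f s :> f' \<Longrightarrow> DERIV (\<lambda>s. kink (f s)) s :> kink1 (f s) * f'"
proof -
  have eq: "kink = (\<lambda>s. s * (s * \<bar>s\<bar>) - s ^ 3)"
    by (auto simp: kink_def power3_eq_cube abs_if)
  have "DERIV kink s :> kink1 s" for s
    unfolding eq kink1_def
    by (rule derivative_eq_intros DERIV_mult_abs refl | simp)+
  then show "DERIV f s :> f' \<Longrightarrow> DERIV (\<lambda>s. kink (f s)) s :> kink1 (f s) * f'"
    using DERIV_chain2 by blast
qed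

lemma DERIV_kink1 [derivative_intros]:
  "DERIV f s :> f' \<Longrightarrow> DERIV (\<lambda>s. kink1 (f s)) s :> kink2 (f s) * f'"
proof -
  have "DERIV (\<lambda>s. 3 * (s * \<bar>s\<bar>) - 3 * s\<^sup>2) s :> kink2 s" for s
    unfolding kink2_def by (rule derivative_eq_intros DERIV_mult_abs refl | simp)+
  then have "DERIV kink1 s :> kink2 s" for s
    by (simp add: kink1_def [abs_def] mult.assoc)
  then show "DERIV f s :> f' \<Longrightarrow> DERIV (\<lambda>s. kink1 (f s)) s :> kink2 (f s) * f'"
    using DERIV_chain2 by blast
qed

section \<open>One-variable coefficients and their derivatives\<close>

definition den :: "real \<Rightarrow> real" where
  "den s = (3 + 2 * s + kink s) * (2 + s)"

definition den1 :: "real \<Rightarrow> real" where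
  "den1 s = (2 + kink1 s) * (2 + s) + (3 + 2 * s + kink s)"

definition den2 :: "real \<Rightarrow> real" where
  "den2 s = kink2 s * (2 + s) + 2 * (2 + kink1 s)"

lemma den_pos:
  assumes "s > -2"
  shows "den s > 0"
proof (cases "s \<ge> 0")
  case True
  then show ?thesis by (simp add: den_def kink_nonneg_arg)
next
  case False
  \<comment> \<open>For negative \<open>s\<close> the first factor of \<open>den\<close> is this
    cubic. Splitting off \<open>- 2 * s * (s + 1/2)\<^sup>2\<close> absorbs the cubic term and
    leaves \<open>2 * s\<^sup>2 + 5/2 * s + 3\<close>, whose square is then completed.\<close>
  have "3 + 2 * s - 2 * s ^ 3 = 2 * (- s) * (s + 1 / 2)\<^sup>2 + 2 * (s + 5/8)\<^sup>2 + (3 - 25 / 32)"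
    by (simp add: power2_eq_square power3_eq_cube algebra_simps)
  moreover have "2 * (- s) * (s + 1 / 2)\<^sup>2 \<ge> 0" "2 * (s + 5/8)\<^sup>2 \<ge> 0"
    using False by (auto intro!: mult_nonneg_nonneg mult_nonpos_nonneg)
  ultimately have "3 + 2 * s - 2 * s ^ 3 > 0" by linarith
  with False assms show ?thesis by (simp add: den_def kink_neg_arg)
qed

text \<open>Expanding the square turns the potential into \<open>alpha(S) + beta(S) q + q\<^sup>2\<close>.\<close>

definition alpha :: "real \<Rightarrow> real" where
  "alpha s = - (9/8) * s\<^sup>2 / (2 + s) + (s * (3/2 + s)\<^sup>2)\<^sup>2 + 6 * kink s"

definition alpha1 :: "real \<Rightarrow> real" where
  "alpha1 s = - (9/8) + (9/2) / (2 + s)\<^sup>2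
     + 2 * (s * (3/2 + s)\<^sup>2) * (9/4 + 6 * s + 3 * s\<^sup>2) + 6 * kink1 s"

definition alpha2 :: "real \<Rightarrow> real" where
  "alpha2 s = - 9 / (2 + s) ^ 3 + 2 * (9/4 + 6 * s + 3 * s\<^sup>2)\<^sup>2
     + 2 * (s * (3/2 + s)\<^sup>2) * (6 + 6 * s) + 6 * kink2 s"

definition beta :: "real \<Rightarrow> real" where
  "beta s = 9 / den s - 2 * (s * (3/2 + s)\<^sup>2)"

definition beta1 :: "real \<Rightarrow> real" where
  "beta1 s = - 9 * den1 s / (den s)\<^sup>2 - 2 * (9/4 + 6 * s + 3 * s\<^sup>2)"

definition beta2 :: "real \<Rightarrow> real" where
  "beta2 s = - 9 * den2 s / (den s)\<^sup>2 + 18 * (den1 s)\<^sup>2 / (den s) ^ 3 - 2 * (6 + 6 * s)"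

lemma DERIV_cubic:
  "DERIV (\<lambda>s. s * (3/2 + s)\<^sup>2) s :> 9/4 + 6 * s + 3 * (s::real)\<^sup>2"
  by (auto intro!: derivative_eq_intros simp: power2_eq_square algebra_simps)

lemma DERIV_quadratic:
  "DERIV (\<lambda>s. 9/4 + 6 * s + 3 * s\<^sup>2) s :> 6 + 6 * (s::real)"
  by (auto intro!: derivative_eq_intros)

lemma DERIV_den: "DERIV den s :> den1 s" "DERIV den1 s :> den2 s"
  unfolding den_def [abs_def] den1_def den1_def [abs_def] den2_def
  by (auto intro!: derivative_eq_intros simp: algebra_simps)

lemma DERIV_const_divide_power:
  fixes f :: "real \<Rightarrow> real"
  assumes "DERIV f x :> d" "f x \<noteq> 0"
  shows "DERIV (\<lambda>x. c / f x ^ n) x :> - (real n * c * d) / f x ^ Suc n"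
proof -
  have "DERIV (\<lambda>x. c / f x ^ n) x :> - (c * (real n * (d * f x ^ (n - 1)))) / (f x ^ n * f x ^ n)"
    by (rule derivative_eq_intros assms refl | use assms in simp)+
  \<comment> \<open>For \<open>n = 0\<close> the exponent \<open>n - 1\<close> truncates to 0, but
    the factor \<open>real n\<close> makes both sides vanish.\<close>
  moreover have "- (c * (real n * (d * f x ^ (n - 1)))) / (f x ^ n * f x ^ n)
      = - (real n * c * d) / f x ^ Suc n"
    using assms(2) by (cases n) (simp_all add: divide_simps)
  ultimately show ?thesis by simp
qed

lemma DERIV_alpha:
  assumes "s > -2"
  shows "DERIV alpha s :> alpha1 s"
proof -
  have inv: "DERIV (\<lambda>s. c / (2 + s) ^ n) s :> - (real n * c * 1) / (2 + s) ^ Suc n" for c n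
    using assms by (intro DERIV_const_divide_power) (auto intro!: derivative_eq_intros)
  \<comment> \<open>Partial fractions: \<open>(9/8) * (2 - s) - (9/2) / (2 + s)\<close> equals the
    quotient in \<open>alpha\<close> where \<open>s \<noteq> -2\<close>, so the derivative is
    carried over on the open half-line \<open>{-2<..}\<close>.\<close>
  have d: "DERIV (\<lambda>s. (9/8) * (2 - s) - (9/2) / (2 + s) ^ 1 + (s * (3/2 + s)\<^sup>2)\<^sup>2 + 6 * kink s) s :> alpha1 s"
    apply (rule DERIV_cong)
     apply (rule inv DERIV_cubic derivative_intros)+
    apply (simp add: alpha1_def numeral_2_eq_2)
    done
  have eq: "(9/8) * (2 - x) - (9/2) / (2 + x) ^ 1 + (x * (3/2 + x)\<^sup>2)\<^sup>2 + 6 * kink x = alpha x"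
    if "x \<in> {-2<..}" for x
  proof -
    have "(9/8) * (2 - x) - (9/2) / (2 + x) = - (9/8) * x\<^sup>2 / (2 + x)"
      using that by (simp add: divide_simps) (simp add: algebra_simps power2_eq_square)
    then show ?thesis by (simp only: alpha_def power_one_right)
  qed
  show ?thesis
    by (rule has_field_derivative_transform_within_open [OF d open_greaterThan _ eq])
      (use assms in auto)
qed

lemma DERIV_alpha1:
  assumes "s > -2"
  shows "DERIV alpha1 s :> alpha2 s"
proof -
  have inv: "DERIV (\<lambda>s. c / (2 + s) ^ n) s :> - (real n * c * 1) / (2 + s) ^ Suc n" for c n
    using assms by (intro DERIV_const_divide_power) (auto intro!: derivative_eq_intros)
  have "DERIV (\<lambda>s. - (9/8) + (9/2) / (2 + s)\<^sup>2
      + 2 * ((s * (3/2 + s)\<^sup>2) * (9/4 + 6 * s + 3 * s\<^sup>2)) + 6 * kink1 s) s :> alpha2 s"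
    apply (rule DERIV_cong)
     apply (rule inv DERIV_cubic DERIV_quadratic derivative_intros)+
    apply (simp add: alpha2_def power2_eq_square power3_eq_cube)
    done
  then show ?thesis
    by (simp add: alpha1_def [abs_def] algebra_simps)
qed

lemma DERIV_beta:
  assumes "s > -2"
  shows "DERIV beta s :> beta1 s"
proof -
  have inv: "DERIV (\<lambda>s. c / den s ^ n) s :> - (real n * c * den1 s) / den s ^ Suc n" for c n
    using den_pos [OF assms] by (intro DERIV_const_divide_power DERIV_den) auto
  have "DERIV (\<lambda>s. 9 / den s ^ 1 - 2 * (s * (3/2 + s)\<^sup>2)) s :> beta1 s"
    apply (rule DERIV_cong)
     apply (rule inv DERIV_cubic DERIV_den derivative_intros)+
    apply (simp add: beta1_def power2_eq_square)
    done
  then show ?thesis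
    by (simp add: beta_def [abs_def])
qed

lemma DERIV_beta1:
  assumes "s > -2"
  shows "DERIV beta1 s :> beta2 s"
proof -
  have inv: "DERIV (\<lambda>s. c / den s ^ n) s :> - (real n * c * den1 s) / den s ^ Suc n" for c n
    using den_pos [OF assms] by (intro DERIV_const_divide_power DERIV_den) auto
  have "DERIV (\<lambda>s. - 9 * (den1 s * (1 / (den s)\<^sup>2)) - 2 * (9/4 + 6 * s + 3 * s\<^sup>2)) s :> beta2 s"
    apply (rule DERIV_cong)
     apply (rule inv DERIV_quadratic DERIV_den derivative_intros)+
    apply (simp add: beta2_def power2_eq_square power3_eq_cube algebra_simps)
    done
  then show ?thesis
    by (simp add: beta1_def [abs_def])
qed

section \<open>Positivity in the variables S and q\<close>

text \<open>The only negative contribution is \<open>- (9/8) * s\<^sup>2 / (2 + s)\<close>. For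
  \<open>s > 0\<close> it is beaten by the term in \<open>q / den s\<close> or by the square
  \<open>(q - b)\<^sup>2\<close>; for \<open>s < 0\<close> by the square near 0 and by
  \<open>kink\<close> farther out.\<close>

lemma positive_of_radial:
  fixes s q :: real
  assumes s: "s \<ge> - 16/9" and q: "q \<ge> 0" and nz: "s \<noteq> 0 \<or> q \<noteq> 0"
  shows "alpha s + beta s * q + q\<^sup>2 > 0"
proof -
  define b where "b = s * (3/2 + s)\<^sup>2"
  have eq: "alpha s + beta s * q + q\<^sup>2 =
      9 * q / den s - (9/8) * s\<^sup>2 / (2 + s) + (q - b)\<^sup>2 + 6 * kink s"
    unfolding alpha_def beta_def b_def by (simp add: power2_eq_square algebra_simps)
  have gq: "9 * q / den s \<ge> 0" using den_pos [of s] s q by simp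
  consider "s = 0" | "s > 0" | "s < 0" by linarith
  then show ?thesis
  proof cases
    case 1
    then have "q > 0" using nz q by auto
    then show ?thesis using 1 unfolding eq by (simp add: kink_def den_def b_def add_pos_nonneg)
  next
    case 2
    have g: "9 * q / den s = (9 * q / (3 + 2 * s)) / (2 + s)"
      using 2 by (simp add: den_def kink_nonneg_arg)
    show ?thesis
    \<comment> \<open>Large \<open>q\<close> makes \<open>9 * q / (3 + 2 * s)\<close> exceed
      \<open>9 * s\<^sup>2 / 8\<close>. Small \<open>q\<close> is at distance at least
      \<open>b / 2 \<ge> (9/8) * s\<close> from \<open>b\<close>, so the square is at least
      \<open>(81/64) * s\<^sup>2\<close>, against a loss of at most
      \<open>(9/16) * s\<^sup>2\<close>.\<close>
    proof (cases "q \<ge> b / 2")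
      case True
      have "9 * s\<^sup>2 / 8 < 9 * s * (3 + 2 * s) / 8"
        using 2 by (simp add: power2_eq_square algebra_simps add_pos_pos)
      also have "\<dots> = 9 * (b / 2) / (3 + 2 * s)"
        using 2 by (simp add: b_def power2_eq_square divide_simps) (simp add: algebra_simps)
      also have "\<dots> \<le> 9 * q / (3 + 2 * s)"
        using True 2 by (intro divide_right_mono) auto
      finally have "(9 * s\<^sup>2 / 8) / (2 + s) < 9 * q / den s"
        unfolding g using 2 by (intro divide_strict_right_mono) auto
      moreover have "(q - b)\<^sup>2 \<ge> 0" by simp
      ultimately show ?thesis
        using 2 unfolding eq by (simp add: kink_nonneg_arg add_pos_nonneg)
    next
      case False
      have "(3/2 + s)\<^sup>2 \<ge> (3/2)\<^sup>2" using 2 by (intro power_mono) auto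
      then have "s * (3/2 + s)\<^sup>2 \<ge> s * (3/2)\<^sup>2" using 2 by (intro mult_left_mono) auto
      then have "b - q \<ge> (9/8) * s" using False by (simp add: b_def power2_eq_square)
      then have "(b - q)\<^sup>2 \<ge> ((9/8) * s)\<^sup>2" using 2 by (intro power_mono) auto
      then have "(q - b)\<^sup>2 \<ge> (81/64) * s\<^sup>2" by (simp add: power2_commute power_mult_distrib power_divide)
      moreover have "(9/8) * s\<^sup>2 / (2 + s) \<le> (9/8) * s\<^sup>2 / 2"
        using 2 by (intro divide_left_mono) auto
      moreover have "s\<^sup>2 > 0" "kink s = 0" using 2 by (simp_all add: kink_nonneg_arg)
      ultimately show ?thesis
        using gq unfolding eq by linarith
    qed
  next
    case 3
    have s2: "s\<^sup>2 > 0" using 3 by simp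
    have kn: "6 * kink s = 12 * (- s) * s\<^sup>2"
      using 3 by (simp add: kink_neg_arg power2_eq_square power3_eq_cube)
    show ?thesis
    \<comment> \<open>Above \<open>- 1/2\<close> the square gives \<open>s\<^sup>2\<close> against a
      loss of \<open>(3/4) * s\<^sup>2\<close>. Below it, \<open>2 + s \<ge> 2/9\<close> limits the
      loss to \<open>(81/16) * s\<^sup>2\<close>, and the coefficient 6 of \<open>kink\<close> is
      large enough to gain \<open>6 * s\<^sup>2\<close>.\<close>
    proof (cases "s \<ge> - 1/2")
      case True
      have "(3/2 + s)\<^sup>2 \<ge> 1\<^sup>2" using True by (intro power_mono) auto
      then have "(- s) * (3/2 + s)\<^sup>2 \<ge> (- s) * 1" using 3 by (intro mult_left_mono) auto
      then have "q - b \<ge> - s" using q by (simp add: b_def)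
      then have sq: "(q - b)\<^sup>2 \<ge> (- s)\<^sup>2" using 3 by (intro power_mono) auto
      have "(9/8) * s\<^sup>2 / (2 + s) \<le> (9/8) * s\<^sup>2 / (3/2)"
        using True by (intro divide_left_mono) auto
      then have le: "(9/8) * s\<^sup>2 / (2 + s) \<le> (3/4) * s\<^sup>2" by simp
      have "6 * kink s \<ge> 0"
        unfolding kn using 3 by (intro mult_nonneg_nonneg) auto
      then show ?thesis
        using gq s2 le sq unfolding eq power2_minus by linarith
    next
      case False
      have "(9/8) * s\<^sup>2 / (2 + s) \<le> (9/8) * s\<^sup>2 / (2/9)"
        using s by (intro divide_left_mono) auto
      then have "(9/8) * s\<^sup>2 / (2 + s) \<le> (81/16) * s\<^sup>2" by simp
      moreover have "12 * (- s) * s\<^sup>2 \<ge> 6 * s\<^sup>2"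
        using False by (intro mult_right_mono) auto
      moreover have "(q - b)\<^sup>2 \<ge> 0" by simp
      ultimately show ?thesis
        using gq s2 unfolding eq kn by linarith
    qed
  qed
qed

section \<open>The potential on the plane and its differentials\<close>

definition radial :: "real^2 \<Rightarrow> real" where
  "radial v = 4/9 * ((v$1)\<^sup>2 + (v$2)\<^sup>2 - 4)"

definition potential :: "real^2 \<Rightarrow> real" where
  "potential v = alpha (radial v) + beta (radial v) * (v$2)\<^sup>2 + ((v$2)\<^sup>2)\<^sup>2"

text \<open>The gradient of \<open>radial\<close> is \<open>8/9\<close> times the position vector,
  so this is the factor multiplying \<open>v\<close> in the part of the gradient that comes from the
  dependence on S with q held fixed.\<close>

definition slope :: "real^2 \<Rightarrow> real" where
  "slope v = 8/9 * (alpha1 (radial v) + beta1 (radial v) * (v$2)\<^sup>2)"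

definition potential_grad :: "real^2 \<Rightarrow> real^2" where
  "potential_grad v = vector [v$1 * slope v,
     v$2 * (slope v + 2 * beta (radial v) + 4 * (v$2)\<^sup>2)]"

definition slope1 :: "real^2 \<Rightarrow> real" where
  "slope1 v = 64/81 * (alpha2 (radial v) + beta2 (radial v) * (v$2)\<^sup>2)"

definition potential_hessian :: "real^2 \<Rightarrow> real^2^2" where
  "potential_hessian v =
    (let m = v$1 * v$2 * (slope1 v + 16/9 * beta1 (radial v))
     in vector [vector [slope v + (v$1)\<^sup>2 * slope1 v, m],
          vector [m, slope v + 2 * beta (radial v) + 12 * (v$2)\<^sup>2
            + (v$2)\<^sup>2 * (slope1 v + 32/9 * beta1 (radial v))]])"

text \<open>The minimum is at the origin. It lies to the right of -2, so the one-variable results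
  for \<open>s > -2\<close> apply on the whole plane.\<close>

lemma radial_ge: "radial v \<ge> - 16/9"
  unfolding radial_def by simp

lemma radial_gt: "radial v > -2"
  using radial_ge [of v] by linarith

lemma has_derivative_radial:
  "(radial has_derivative (\<lambda>h. 8/9 * (v$1 * h$1 + v$2 * h$2))) (at v)"
  unfolding radial_def [abs_def]
  by (auto intro!: derivative_eq_intros bounded_linear.has_derivative [OF bounded_linear_vec_nth]
      simp: algebra_simps)

lemma has_derivative_of_radial:
  assumes "DERIV f (radial v) :> f'"
  shows "((\<lambda>v. f (radial v)) has_derivative (\<lambda>h. 8/9 * (v$1 * h$1 + v$2 * h$2) * f')) (at v)"
  by (rule DERIV_compose_FDERIV [OF assms has_derivative_radial])

lemmas radial_derivatives =
  has_derivative_of_radial [OF DERIV_alpha [OF radial_gt]]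
  has_derivative_of_radial [OF DERIV_alpha1 [OF radial_gt]]
  has_derivative_of_radial [OF DERIV_beta [OF radial_gt]]
  has_derivative_of_radial [OF DERIV_beta1 [OF radial_gt]]
  bounded_linear.has_derivative [OF bounded_linear_vec_nth]

lemma inner_vector_2: "(x :: real^2) \<bullet> y = x$1 * y$1 + x$2 * y$2"
  by (simp add: inner_vec_def sum_2)

lemma has_derivative_potential:
  "(potential has_derivative (\<lambda>h. h \<bullet> potential_grad v)) (at v)"
  unfolding potential_def [abs_def]
  apply (rule derivative_eq_intros radial_derivatives refl)+
  apply (simp add: fun_eq_iff inner_vector_2 potential_grad_def slope_def algebra_simps
     power2_eq_square)
  done

lemma has_derivative_slope:
  "(slope has_derivative (\<lambda>h. (v$1 * h$1 + v$2 * h$2) * slope1 v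
     + 16/9 * beta1 (radial v) * v$2 * h$2)) (at v)"
  unfolding slope_def [abs_def]
  apply (rule derivative_eq_intros radial_derivatives refl)+
  apply (simp add: fun_eq_iff slope1_def algebra_simps add_divide_distrib power2_eq_square)
  done

lemma has_derivative_vector_2:
  fixes f g :: "'a::real_normed_vector \<Rightarrow> real"
  assumes "(f has_derivative f') F" "(g has_derivative g') F"
  shows "((\<lambda>x. vector [f x, g x] :: real^2) has_derivative (\<lambda>h. vector [f' h, g' h])) F"
proof -
  have eq: "vector [a, b] = a *\<^sub>R axis 1 1 + b *\<^sub>R (axis 2 1 :: real^2)" for a b
    by (simp add: vec_eq_iff forall_2 axis_def)
  show ?thesis
    unfolding eq by (intro derivative_intros assms)
qed

lemma has_derivative_potential_grad:
  "(potential_grad has_derivative (\<lambda>h. potential_hessian v *v h)) (at v)"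
proof -
  \<comment> \<open>The matrix product is rearranged into the shape that the product rule yields for
    each component of \<open>potential_grad\<close>.\<close>
  have eq: "(\<lambda>h. potential_hessian v *v h) =
    (\<lambda>h. vector [v$1 * ((v$1 * h$1 + v$2 * h$2) * slope1 v + 16/9 * beta1 (radial v) * v$2 * h$2)
         + h$1 * slope v,
       v$2 * ((v$1 * h$1 + v$2 * h$2) * slope1 v + 16/9 * beta1 (radial v) * v$2 * h$2
         + 2 * (8/9 * (v$1 * h$1 + v$2 * h$2) * beta1 (radial v)) + 8 * v$2 * h$2)
       + h$2 * (slope v + 2 * beta (radial v) + 4 * (v$2)\<^sup>2)])"
    by (simp add: fun_eq_iff vec_eq_iff forall_2 potential_hessian_def Let_def
       matrix_vector_mult_def sum_2 algebra_simps power2_eq_square)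
  show ?thesis
    unfolding eq unfolding potential_grad_def [abs_def]
    by (rule has_derivative_vector_2;
        (rule derivative_eq_intros radial_derivatives has_derivative_slope refl)+;
        simp add: fun_eq_iff algebra_simps)
qed

section \<open>Identification of gradient and Hessian, and their regularity\<close>

text \<open>Uniqueness of the derivative determines \<open>h \<bullet> D\<close> for every
  \<open>h\<close>, and hence \<open>D\<close>, so the definite description in \<open>grad\<close>
  is meaningful.\<close>

lemma grad_eqI:
  assumes "(f has_derivative (\<lambda>h. h \<bullet> D)) (at x)"
  shows "grad f x = D"
  unfolding grad_def gderiv_def
proof (rule the_equality)
  fix E assume "(f has_derivative (\<lambda>h. h \<bullet> E)) (at x)"
  with assms have "(\<lambda>h. h \<bullet> E) = (\<lambda>h. h \<bullet> D)" by (metis has_derivative_unique)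
  then have "h \<bullet> E = h \<bullet> D" for h by meson
  then show "E = D" by (metis vector_eq_ldot)
qed (fact assms)

lemma hessian_eqI:
  assumes "(grad f has_derivative (\<lambda>h. H *v h)) (at x)"
  shows "hessian f x = H"
  using frechet_derivative_at [OF assms] unfolding hessian_def
  by (metis matrix_of_matrix_vector_mul)

lemma grad_potential: "grad potential = potential_grad"
  using grad_eqI has_derivative_potential by blast

lemma hessian_potential: "hessian potential = potential_hessian"
  by (rule ext, rule hessian_eqI) (simp add: grad_potential has_derivative_potential_grad)

lemma continuous_on_vector_2:
  fixes f g :: "'a::topological_space \<Rightarrow> 'b::real_normed_vector"
  assumes "continuous_on S f" "continuous_on S g"
  shows "continuous_on S (\<lambda>x. vector [f x, g x] :: 'b^2)"
proof -
  have eq: "(vector [a, b] :: 'b^2) = (\<chi> i. if i = 1 then a else b)" for a b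
    by (simp add: vec_eq_iff forall_2)
  show ?thesis unfolding eq
  proof (rule continuous_on_vec_lambda)
    show "continuous_on S (\<lambda>x. if i = 1 then f x else g x)" for i :: 2
      using assms by (cases "i = 1") auto
  qed
qed

text \<open>Neither \<open>2 + s\<close> nor \<open>den s\<close> vanishes for
  \<open>s > -2\<close>, so the coefficients are continuous there; composing with
  \<open>radial\<close>, whose values stay in that range, gives continuity on the plane.\<close>

lemma continuous_on_potential_hessian: "continuous_on UNIV potential_hessian"
proof -
  have k: "continuous_on {-2<..} kink" "continuous_on {-2<..} kink1" "continuous_on {-2<..} kink2"
    unfolding kink_def [abs_def] kink1_def [abs_def] kink2_def [abs_def]
    by (intro continuous_intros)+
  have d: "continuous_on {-2<..} den" "continuous_on {-2<..} den1" "continuous_on {-2<..} den2"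
    unfolding den_def [abs_def] den1_def [abs_def] den2_def [abs_def]
    by (intro continuous_intros k)+
  have nz: "\<forall>x\<in>{-2<..}. den x \<noteq> 0" using den_pos by fastforce
  have r: "continuous_on UNIV radial"
    unfolding radial_def [abs_def] by (intro continuous_intros)
  have comp: "continuous_on UNIV (\<lambda>v. f (radial v))"
    if "continuous_on {-2<..} f" for f :: "real \<Rightarrow> real"
    by (rule continuous_on_compose2 [OF that r]) (auto simp: radial_gt)
  have "continuous_on {-2<..} alpha1" "continuous_on {-2<..} alpha2"
    unfolding alpha1_def [abs_def] alpha2_def [abs_def]
    by (intro continuous_intros k; force)+
  moreover have "continuous_on {-2<..} beta" "continuous_on {-2<..} beta1" "continuous_on {-2<..} beta2"
    unfolding beta_def [abs_def] beta1_def [abs_def] beta2_def [abs_def]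
    by (intro continuous_intros d; use nz in auto)+
  ultimately show ?thesis
    unfolding potential_hessian_def [abs_def] Let_def slope_def slope1_def
    by (intro continuous_on_vector_2 continuous_intros comp)
qed

lemma C2_potential: "C2 potential"
  unfolding C2_def hessian_potential grad_potential
  using has_derivative_potential has_derivative_potential_grad continuous_on_potential_hessian
  by (auto simp: differentiable_def)

section \<open>The two zeros of the potential\<close>

text \<open>Both points have S = 0 and \<open>v$2 = 0\<close>, where \<open>slope\<close> is 0 and
  \<open>slope1\<close> is \<open>64/9\<close>. The diagonal entries are thus
  \<open>4 * (64/9)\<close> and \<open>2 * beta 0 = 18/6\<close>.\<close>

lemma potential_hessian_at_zeros:
  assumes "v = a_plus \<or> v = a_minus"
  shows "potential_hessian v = vector [vector [256/9, 0], vector [0, 3]]"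
  using assms
  by (auto simp: a_plus_def a_minus_def potential_hessian_def slope_def slope1_def radial_def
      alpha1_def alpha2_def beta_def den_def kink_nonneg_arg power2_eq_square)

lemma positive_definite_diagonal:
  assumes "a > 0" "d > 0"
  shows "positive_definite (vector [vector [a, 0], vector [0, d]] :: real^2^2)"
proof -
  have "a * (v$1)\<^sup>2 + d * (v$2)\<^sup>2 > 0" if "v \<noteq> 0" for v :: "real^2"
  proof (cases "v$1 = 0")
    case True
    with that have "v$2 \<noteq> 0" by (auto simp: vec_eq_iff forall_2)
    with True assms show ?thesis by simp
  next
    case False
    with assms show ?thesis by (intro add_pos_nonneg) auto
  qed
  then have "v \<bullet> ((vector [vector [a, 0], vector [0, d]] :: real^2^2) *v v) > 0"
    if "v \<noteq> 0" for v :: "real^2"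
    using that by (simp add: matrix_vector_mult_def inner_vector_2 sum_2 power2_eq_square ac_simps)
  then show ?thesis
    by (auto simp: positive_definite_def transpose_def vec_eq_iff forall_2)
qed

lemma potential_pos:
  assumes "v \<notin> {a_plus, a_minus}"
  shows "potential v > 0"
proof -
  \<comment> \<open>S and q vanish together only on the horizontal axis at distance 2 from the
    origin.\<close>
  have "radial v \<noteq> 0 \<or> (v$2)\<^sup>2 \<noteq> 0"
  proof (rule ccontr)
    assume "\<not> ?thesis"
    then have "v$2 = 0" "(v$1)\<^sup>2 = 2\<^sup>2" by (auto simp: radial_def)
    then have "v$2 = 0" "v$1 = 2 \<or> v$1 = -2" by (auto simp only: power2_eq_iff)
    with assms show False
      by (auto simp: a_plus_def a_minus_def vec_eq_iff forall_2)
  qed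
  then show ?thesis
    unfolding potential_def by (intro positive_of_radial radial_ge) auto
qed

section \<open>The periodic orbit and its equation of motion\<close>

text \<open>Real and imaginary parts of the epicyclic curve, with \<open>cos (3 * x)\<close> and
  \<open>sin (3 * x)\<close> expanded by the triple-angle formulas.\<close>

definition orbit :: "real \<Rightarrow> real^2" where
  "orbit x = vector [3 * cos x - cos x ^ 3, 3/2 * sin x + sin x ^ 3]"

definition velocity :: "real \<Rightarrow> real^2" where
  "velocity x = vector [- 3 * sin x ^ 3, cos x * (3/2 + 3 * (sin x)\<^sup>2)]"

lemma has_vector_derivative_vector_2:
  assumes "DERIV f x :> f'" "DERIV g x :> g'"
  shows "((\<lambda>x. vector [f x, g x] :: real^2) has_vector_derivative vector [f', g']) (at x)"
  using has_derivative_vector_2 [OF assms [unfolded has_field_derivative_def]]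
  unfolding has_vector_derivative_def
  by (rule has_derivative_eq_rhs) (auto simp: fun_eq_iff vec_eq_iff forall_2)

lemma orbit_derivative: "(orbit has_vector_derivative velocity x) (at x)"
proof -
  have "- 3 * sin x + 3 * (cos x)\<^sup>2 * sin x = - 3 * sin x ^ 3"
    by (subst cos_squared_eq) (simp add: power2_eq_square power3_eq_cube algebra_simps)
  then have "DERIV (\<lambda>x. 3 * cos x - cos x ^ 3) x :> - 3 * sin x ^ 3"
    by (auto intro!: derivative_eq_intros simp: mult_ac)
  then show ?thesis
    unfolding orbit_def [abs_def] velocity_def
    by (rule has_vector_derivative_vector_2)
     (auto intro!: derivative_eq_intros simp: algebra_simps)
qed

text \<open>The right-hand side is the acceleration of \<open>orbit\<close>. With
  \<open>t = (sin x)\<^sup>2\<close> the curve has S = t and q =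
  \<open>t * (3/2 + t)\<^sup>2\<close>, and \<open>t \<ge> 0\<close> removes every
  \<open>kink\<close> term, leaving rational functions of \<open>t\<close>.\<close>

lemma potential_grad_orbit:
  "potential_grad (orbit x) = vector [- 9 * (sin x)\<^sup>2 * cos x, sin x * (9/2 - 9 * (sin x)\<^sup>2)]"
proof -
  define c s t where "c = cos x" and "s = sin x" and "t = s\<^sup>2"
  have c2: "c\<^sup>2 = 1 - t" unfolding c_def s_def t_def by (rule cos_squared_eq)
  have t0: "t \<ge> 0" by (simp add: t_def)
  have o1: "orbit x $ 1 = c * (2 + t)"
  proof -
    have "3 * c - c ^ 3 = c * (3 - c\<^sup>2)" by (simp add: power2_eq_square power3_eq_cube algebra_simps)
    then show ?thesis by (simp add: orbit_def flip: c_def) (simp add: c2)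
  qed
  have o2: "orbit x $ 2 = s * (3/2 + t)"
    by (simp add: orbit_def t_def power2_eq_square power3_eq_cube algebra_simps flip: s_def)
  have q: "(orbit x $ 2)\<^sup>2 = t * (3/2 + t)\<^sup>2"
    by (simp add: o2 power_mult_distrib t_def)
  have r: "radial (orbit x) = t"
    by (simp add: radial_def q o1 power_mult_distrib c2) (simp add: power2_eq_square algebra_simps)
  have den: "den t = (3 + 2 * t) * (2 + t)" "den1 t = 7 + 4 * t"
    using t0 by (simp_all add: den_def den1_def kink_nonneg_arg)
  have sl: "slope (orbit x) = - 9 * t / (2 + t)"
  proof -
    have "9 * den1 t / (den t)\<^sup>2 * (t * (3/2 + t)\<^sup>2) = 9/4 * t * (7 + 4 * t) / (2 + t)\<^sup>2"
    proof -
      have "(3/2 + t)\<^sup>2 = (3 + 2 * t)\<^sup>2 / 4" by (simp add: power2_eq_square algebra_simps)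
      then show ?thesis using t0
        by (simp add: den power_mult_distrib divide_simps) (simp add: power2_eq_square algebra_simps)
    qed
    \<comment> \<open>Since q equals the cubic, the contributions of the derivative of the squared
      term in \<open>alpha1\<close> and \<open>beta1\<close> cancel.\<close>
    then have "slope (orbit x) = 8/9 * (- (9/8) + (9/2) / (2 + t)\<^sup>2
        - 9/4 * t * (7 + 4 * t) / (2 + t)\<^sup>2)"
      using t0 by (simp add: slope_def r q alpha1_def beta1_def kink_nonneg_arg algebra_simps)
    also have "\<dots> = - 9 * t / (2 + t)"
      using t0 by (simp add: divide_simps power2_eq_square) (simp add: algebra_simps)
    finally show ?thesis .
  qed
  \<comment> \<open>The same coincidence cancels the cubic in \<open>beta\<close> against
    \<open>4 * q\<close>; what remains is twice the prescribed derivative of the potential in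
    q.\<close>
  have b: "2 * beta t + 4 * (t * (3/2 + t)\<^sup>2) = 18 / ((3 + 2 * t) * (2 + t))"
    by (simp add: beta_def den)
  have norm: "slope (orbit x) + 2 * beta (radial (orbit x)) + 4 * (orbit x $ 2)\<^sup>2
      = - 9 * t / (2 + t) + 18 / ((3 + 2 * t) * (2 + t))"
    by (simp only: sl r q add.assoc b)
  \<comment> \<open>The numerator factors as
    \<open>18 - 27 * t - 18 * t\<^sup>2 = 9 * (1 - 2 * t) * (2 + t)\<close>, which cancels
    \<open>2 + t\<close>.\<close>
  have "s * (3/2 + t) * (- 9 * t / (2 + t) + 18 / ((3 + 2 * t) * (2 + t))) = s * (9/2 - 9 * t)"
    using t0 by (simp add: divide_simps) (simp add: algebra_simps)
  moreover have "c * (2 + t) * (- 9 * t / (2 + t)) = - 9 * t * c"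
    using t0 by (simp add: divide_simps)
  ultimately show ?thesis
    unfolding potential_grad_def unfolding norm unfolding sl o1 o2 by (simp only: t_def s_def c_def)
qed

lemma velocity_derivative:
  "(velocity has_vector_derivative potential_grad (orbit x)) (at x)"
proof -
  have "cos x * (6 * sin x * cos x) - sin x * (3/2 + 3 * (sin x)\<^sup>2)
      = 6 * sin x * (cos x)\<^sup>2 - sin x * (3/2 + 3 * (sin x)\<^sup>2)"
    by (simp add: power2_eq_square)
  also have "\<dots> = sin x * (9/2 - 9 * (sin x)\<^sup>2)"
    by (simp add: cos_squared_eq algebra_simps)
  finally have "cos x * (6 * sin x * cos x) - sin x * (3/2 + 3 * (sin x)\<^sup>2)
      = sin x * (9/2 - 9 * (sin x)\<^sup>2)" .
  then show ?thesis
    unfolding potential_grad_orbit unfolding velocity_def [abs_def]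
    by (intro has_vector_derivative_vector_2)
     (auto intro!: derivative_eq_intros simp: algebra_simps)
qed

lemma vector_derivative_orbit: "vector_derivative orbit (at x) = velocity x"
  by (rule vector_derivative_at [OF orbit_derivative])

lemma solves_ode_orbit: "solves_ode potential orbit"
  unfolding solves_ode_def vector_derivative_orbit grad_potential
  using orbit_derivative velocity_derivative
  by (auto intro: differentiableI_vector)

lemma bounded_orbit: "bounded (range orbit)"
proof (rule boundedI)
  fix v assume "v \<in> range orbit"
  then obtain x where v: "v = orbit x" by auto
  have "\<bar>cos x ^ 3\<bar> \<le> 1" "\<bar>sin x ^ 3\<bar> \<le> 1"
    by (simp_all add: power_abs power_le_one)
  then have "\<bar>v$1\<bar> \<le> 4" "\<bar>v$2\<bar> \<le> 4"
    using abs_cos_le_one [of x] abs_sin_le_one [of x] unfolding v orbit_def vector_2 by linarith+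
  then show "norm v \<le> 8"
    using norm_le_l1_cart [of v] by (simp add: sum_2)
qed

theorem mainTheorem1:
  shows "\<exists>(W :: real^2 \<Rightarrow> real) (T :: real) (u :: real \<Rightarrow> real^2).
    C2 W \<and> T > 0 \<and> solves_ode W u \<and>
    (W a_plus = 0 \<and> W a_minus = 0 \<and> (\<forall>v. v \<notin> {a_plus, a_minus} \<longrightarrow> W v > 0)) \<and>
    (positive_definite (hessian W a_plus) \<and> positive_definite (hessian W a_minus)) \<and>
    (\<forall>v1 v2. W (vector [v1, v2]) = W (vector [- v1, v2]) \<and>
             W (vector [v1, v2]) = W (vector [v1, - v2])) \<and>
    (\<forall>x. u (x + T) = u x) \<and>
    (u 0 = a_plus \<and> u (T / 2) = a_minus) \<and>
    (vector_derivative u (at 0) \<noteq> 0 \<and> vector_derivative u (at (T / 2)) \<noteq> 0) \<and>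
    (bounded (range u) \<and> \<not> u constant_on UNIV \<and> W (u 0) = 0 \<and>
     1 / 2 * (norm (vector_derivative u (at 0)))\<^sup>2 > W (u 0))"
proof -
  have u: "orbit 0 = a_plus" "orbit pi = a_minus"
    by (simp_all add: orbit_def a_plus_def a_minus_def)
  \<comment> \<open>The second components are \<open>3/2\<close> and \<open>- 3/2\<close>. As the
    potential vanishes at \<open>orbit 0\<close>, the strict energy inequality also follows from
    this.\<close>
  have vel: "velocity 0 \<noteq> 0" "velocity pi \<noteq> 0"
    by (auto simp: velocity_def vec_eq_iff forall_2)
  have W: "potential a_plus = 0" "potential a_minus = 0"
    by (simp_all add: potential_def a_plus_def a_minus_def radial_def alpha_def kink_def)
  have "a_plus \<noteq> a_minus"
    by (simp add: a_plus_def a_minus_def vec_eq_iff forall_2)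
  then have "\<not> orbit constant_on UNIV"
    using u by (metis UNIV_I constant_on_def)
  moreover have "\<forall>v1 v2. potential (vector [v1, v2]) = potential (vector [- v1, v2]) \<and>
             potential (vector [v1, v2]) = potential (vector [v1, - v2])"
    by (simp add: potential_def radial_def)
  moreover have "\<forall>x. orbit (x + 2 * pi) = orbit x"
    by (simp add: orbit_def)
  moreover have "positive_definite (hessian potential a_plus)"
    "positive_definite (hessian potential a_minus)"
    by (simp_all add: hessian_potential potential_hessian_at_zeros positive_definite_diagonal)
  ultimately show ?thesis
    using C2_potential solves_ode_orbit u vel W potential_pos bounded_orbit
    by (intro exI [of _ potential] exI [of _ "2 * pi"] exI [of _ orbit] conjI)
      (simp_all add: vector_derivative_orbit)
qed

end
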